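(* Any proper $3$-vertex cyclically ordered quiver is totally proper.
   Context: A quiver is a finite directed graph without loops or oriented 2-cycles; multiple arrows are allowed. Mutation $\mu_j$ of a quiver at a vertex $j$: for each path $i\to j\to k$ add an arrow $i\to k$; reverse all arrows incident to $j$; repeatedly remove oriented 2-cycles. A cyclic ordering $\sigma=(v_1,\dots,v_n)$ of the vertex set is a linear ordering considered up to cyclic shifts ("clockwise" placement on a circle). A cyclically ordered quiver (COQ) $(Q,\sigma)$ is a quiver with a cyclic ordering of its vertices. A wiggle transforms $(Q,\sigma)$ into $(Q,\sigma')$ where $\sigma'$ is obtained from $\sigma$ by interchanging two vertices that are consecutive in $\sigma$ and not adjacent in $Q$. Wiggle equivalence is the equivalence relation generated by wiggles. A path $i\to j\to k$ in $Q$ makes a right turn at $j$ if $\sigma=(\dots,i,\dots,j,\dots,k,\dots)$. A vertex $j$ is proper in $(Q,\sigma)$ if every oriented two-arrow path $i\to j\to k$ in $Q$ makes a right turn at $j$. A COQ $(Q,\sigma)$ is proper if for every vertex $j$ there is a COQ wiggle equivalent to $(Q,\sigma)$ (possibly depending on $j$) in which $j$ is proper. Let $\operatorname{In}(j)$ (resp., $\operatorname{Out}(j)$) be the set of vertices $i$ with an arrow $i\to j$ (resp., $j\to i$) in $Q$. If $j$ is proper in $(Q,\sigma)$, the proper mutation $\mu_j(Q,\sigma)$ is the quiver $\mu_j(Q)$ with the cyclic ordering obtained from $\sigma$ by keeping the placement of all vertices other than $j$ and moving $j$ clockwise past all the vertices in $\operatorname{Out}(j)$ (each exactly once) without passing any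 vertex in $\operatorname{In}(j)$ (well defined up to wiggles; for a sink or source $j$ the cyclic ordering does not change, up to wiggles). The proper mutation class of a COQ consists of all COQs obtained from it by repeated proper mutations and wiggles. A COQ is totally proper if all COQs in its proper mutation class are proper. *)

theory Defs
  imports Main
begin

text \<open>\<open>arrows Q i j\<close> is the number of arrows from \<open>i\<close> to \<open>j\<close>.\<close>

record 'a quiver =
  verts :: "'a set"
  arrows :: "'a \<Rightarrow> 'a \<Rightarrow> nat"

definition is_quiver :: "'a quiver \<Rightarrow> bool" where
  "is_quiver Q \<longleftrightarrow>
     finite (verts Q) \<and>
     (\<forall>i j. arrows Q i j > 0 \<longrightarrow> i \<in> verts Q \<and> j \<in> verts Q) \<and>
     (\<forall>i. arrows Q i i = 0) \<and>
     (\<forall>i j. arrows Q i j = 0 \<or> arrows Q j i = 0)"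

definition In_nbrs :: "'a quiver \<Rightarrow> 'a \<Rightarrow> 'a set" where
  "In_nbrs Q j = {i. arrows Q i j > 0}"

definition Out_nbrs :: "'a quiver \<Rightarrow> 'a \<Rightarrow> 'a set" where
  "Out_nbrs Q j = {k. arrows Q j k > 0}"

definition adjacent :: "'a quiver \<Rightarrow> 'a \<Rightarrow> 'a \<Rightarrow> bool" where
  "adjacent Q i j \<longleftrightarrow> arrows Q i j > 0 \<or> arrows Q j i > 0"

text \<open>The three steps of quiver mutation act on the matrix of arrow multiplicities.
  There are \<open>a i j * a j k\<close> paths from \<open>i\<close> through \<open>j\<close> to \<open>k\<close>. Removing oriented 2-cycles as
  long as possible cancels \<open>min (a i k) (a k i)\<close> arrows in each direction.\<close>

definition add_composites :: "'a \<Rightarrow> ('a \<Rightarrow> 'a \<Rightarrow> nat) \<Rightarrow> 'a \<Rightarrow> 'a \<Rightarrow> nat" where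
  "add_composites j a i k = a i k + a i j * a j k"

definition reverse_at :: "'a \<Rightarrow> ('a \<Rightarrow> 'a \<Rightarrow> nat) \<Rightarrow> 'a \<Rightarrow> 'a \<Rightarrow> nat" where
  "reverse_at j a i k = (if i = j \<or> k = j then a k i else a i k)"

definition cancel_2cycles :: "('a \<Rightarrow> 'a \<Rightarrow> nat) \<Rightarrow> 'a \<Rightarrow> 'a \<Rightarrow> nat" where
  "cancel_2cycles a i k = a i k - min (a i k) (a k i)"

definition mutate :: "'a \<Rightarrow> 'a quiver \<Rightarrow> 'a quiver" where
  "mutate j Q =
     \<lparr>verts = verts Q,
      arrows = cancel_2cycles (reverse_at j (add_composites j (arrows Q)))\<rparr>"

text \<open>A cyclic ordering is the set of all lists, read clockwise, that represent it.\<close>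

definition cyc :: "'a list \<Rightarrow> 'a list set" where
  "cyc vs = {rotate n vs | n. True}"

definition cyclic_ordering :: "'a set \<Rightarrow> 'a list set \<Rightarrow> bool" where
  "cyclic_ordering V \<sigma> \<longleftrightarrow> (\<exists>vs. distinct vs \<and> set vs = V \<and> \<sigma> = cyc vs)"

type_synonym 'a coq = "'a quiver \<times> 'a list set"

definition is_coq :: "'a coq \<Rightarrow> bool" where
  "is_coq C \<longleftrightarrow> is_quiver (fst C) \<and> cyclic_ordering (verts (fst C)) (snd C)"

text \<open>Since \<open>cyc\<close> forgets the starting point, the vertices \<open>u\<close>, \<open>v\<close> below may also be
  the last and the first entry of a given representative.\<close>

inductive wiggle :: "'a coq \<Rightarrow> 'a coq \<Rightarrow> bool" where
  "\<not> adjacent Q u v \<Longrightarrow>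
     wiggle (Q, cyc (xs @ [u, v] @ ys)) (Q, cyc (xs @ [v, u] @ ys))"

definition wiggle_equivalent :: "'a coq \<Rightarrow> 'a coq \<Rightarrow> bool" where
  "wiggle_equivalent = equivclp wiggle"

definition right_turn :: "'a list set \<Rightarrow> 'a \<Rightarrow> 'a \<Rightarrow> 'a \<Rightarrow> bool" where
  "right_turn \<sigma> i j k \<longleftrightarrow>
     (\<exists>xs ys zs ws. xs @ [i] @ ys @ [j] @ zs @ [k] @ ws \<in> \<sigma>)"

definition proper_vertex :: "'a coq \<Rightarrow> 'a \<Rightarrow> bool" where
  "proper_vertex C j \<longleftrightarrow>
     (\<forall>i k. arrows (fst C) i j > 0 \<and> arrows (fst C) j k > 0 \<longrightarrow> right_turn (snd C) i j k)"

definition proper_coq :: "'a coq \<Rightarrow> bool" where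
  "proper_coq C \<longleftrightarrow>
     (\<forall>j\<in>verts (fst C). \<exists>C'. wiggle_equivalent C C' \<and> proper_vertex C' j)"

text \<open>In the new ordering, \<open>j\<close> has moved clockwise past exactly the vertices in \<open>xs\<close>.
  The resulting ordering is determined only up to wiggles, so proper mutation is a relation
  between COQs, containing every admissible final position of \<open>j\<close>.\<close>

inductive proper_mutation :: "'a \<Rightarrow> 'a coq \<Rightarrow> 'a coq \<Rightarrow> bool" where
  "\<lbrakk>j \<in> verts Q; proper_vertex (Q, cyc (j # xs @ ys)) j;
    Out_nbrs Q j \<subseteq> set xs; In_nbrs Q j \<inter> set xs = {}\<rbrakk> \<Longrightarrow>
   proper_mutation j (Q, cyc (j # xs @ ys)) (mutate j Q, cyc (xs @ j # ys))"

inductive_set proper_mutation_class :: "'a coq \<Rightarrow> 'a coq set" for C :: "'a coq" where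
  base: "C \<in> proper_mutation_class C"
| wiggle: "\<lbrakk>D \<in> proper_mutation_class C; wiggle D D'\<rbrakk> \<Longrightarrow> D' \<in> proper_mutation_class C"
| mutation: "\<lbrakk>D \<in> proper_mutation_class C; proper_mutation j D D'\<rbrakk>
    \<Longrightarrow> D' \<in> proper_mutation_class C"

definition totally_proper :: "'a coq \<Rightarrow> bool" where
  "totally_proper C \<longleftrightarrow> (\<forall>D\<in>proper_mutation_class C. proper_coq D)"

end

theory Submission imports Defs begin

text \<open>A 3-vertex COQ with two nonadjacent vertices is always proper. If all vertices are adjacent,
  no wiggle changes the cyclic ordering, and the COQ is proper iff no oriented path of two arrows
  goes around counterclockwise, i.e. at most one of the three adjacent pairs is oriented
  counterclockwise. This condition survives a proper mutation at \<open>j\<close> that leaves the quiver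
  complete: the reversed arrows at \<open>j\<close> run clockwise because \<open>j\<close> has moved past its
  out-neighbours, unless \<open>j\<close> is a sink or a source, when the third pair keeps its
  orientation.\<close>

section \<open>Arrow multiplicities under mutation\<close>

lemma is_quiver_mutate:
  assumes Q: "is_quiver Q" and j: "j \<in> verts Q"
  shows "is_quiver (mutate j Q)"
proof -
  define A where "A = reverse_at j (add_composites j (arrows Q))"
  have arrows: "arrows (mutate j Q) i k = A i k - min (A i k) (A k i)" for i k
    by (simp add: A_def mutate_def cancel_2cycles_def)
  have outside: "arrows Q i k = 0" "arrows Q k i = 0" if "i \<notin> verts Q" for i k
    using Q that by (auto simp: is_quiver_def)
  have "A i k = 0" "A k i = 0" if "i \<notin> verts Q" for i k
    using outside that j by (auto simp: A_def reverse_at_def add_composites_def)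
  then have "i \<in> verts Q \<and> k \<in> verts Q" if "arrows (mutate j Q) i k > 0" for i k
    using that unfolding arrows by (metis diff_0_eq_0 less_irrefl)
  \<comment> \<open>Subtracting the minimum leaves zero in at least one of two opposite
    entries.\<close>
  moreover have "arrows (mutate j Q) i k = 0 \<or> arrows (mutate j Q) k i = 0" for i k
    unfolding arrows by linarith
  moreover have "arrows (mutate j Q) i i = 0" for i
    by (simp add: arrows)
  ultimately show ?thesis
    using Q by (simp add: is_quiver_def mutate_def)
qed

text \<open>Without loops at \<open>j\<close> no composite starts or ends at \<open>j\<close>, and
  without 2-cycles nothing cancels there, so only the reversal acts.\<close>

lemma arrows_mutate_at:
  assumes "is_quiver Q"
  shows "arrows (mutate j Q) j i = arrows Q i j" "arrows (mutate j Q) i j = arrows Q j i"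
proof -
  have z: "arrows Q j j = 0" "arrows Q i j = 0 \<or> arrows Q j i = 0"
    using assms by (auto simp: is_quiver_def)
  then show "arrows (mutate j Q) j i = arrows Q i j" "arrows (mutate j Q) i j = arrows Q j i"
    by (auto simp: mutate_def cancel_2cycles_def reverse_at_def add_composites_def)
qed

text \<open>In truncated subtraction, \<open>x - min x y\<close> equals
  \<open>x - y\<close>.\<close>

lemma arrows_mutate_away:
  assumes "i \<noteq> j" "k \<noteq> j"
  shows "arrows (mutate j Q) i k =
    (arrows Q i k + arrows Q i j * arrows Q j k) - (arrows Q k i + arrows Q k j * arrows Q j i)"
  using assms by (auto simp: mutate_def cancel_2cycles_def reverse_at_def add_composites_def)

lemma verts_mutate [simp]: "verts (mutate j Q) = verts Q"
  by (simp add: mutate_def)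

section \<open>Cyclic orderings of three vertices\<close>

lemma mem_cyc [simp]: "vs \<in> cyc vs"
  unfolding cyc_def by (metis (mono_tags, lifting) mem_Collect_eq rotate0 id_apply)

lemma cyc_triple: "cyc [a, b, c] = {[a, b, c], [b, c, a], [c, a, b]}"
proof
  show "cyc [a, b, c] \<subseteq> {[a, b, c], [b, c, a], [c, a, b]}"
  proof
    fix l assume "l \<in> cyc [a, b, c]"
    then obtain n where "l = rotate n [a, b, c]"
      by (auto simp: cyc_def)
    then have "l = rotate (n mod 3) [a, b, c]"
      using rotate_conv_mod[of n "[a, b, c]"] by simp
    moreover have "n mod 3 = 0 \<or> n mod 3 = 1 \<or> n mod 3 = 2" by arith
    ultimately show "l \<in> {[a, b, c], [b, c, a], [c, a, b]}"
      by (auto simp: numeral_2_eq_2)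
  qed
  have "[a, b, c] = rotate 0 [a, b, c]" "[b, c, a] = rotate 1 [a, b, c]"
    "[c, a, b] = rotate 2 [a, b, c]"
    by (auto simp: numeral_2_eq_2)
  then show "{[a, b, c], [b, c, a], [c, a, b]} \<subseteq> cyc [a, b, c]"
    unfolding cyc_def by blast
qed

lemma right_turn_triple:
  "right_turn (cyc [a, b, c]) i j k \<longleftrightarrow> (i, j, k) \<in> {(a, b, c), (b, c, a), (c, a, b)}"
proof
  assume "right_turn (cyc [a, b, c]) i j k"
  then obtain xs ys zs ws where mem: "xs @ [i] @ ys @ [j] @ zs @ [k] @ ws \<in> cyc [a, b, c]"
    by (auto simp: right_turn_def)
  \<comment> \<open>Length 3 leaves no room for entries around or between \<open>i\<close>,
    \<open>j\<close> and \<open>k\<close>.\<close>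
  then have "length (xs @ [i] @ ys @ [j] @ zs @ [k] @ ws) = 3"
    unfolding cyc_triple by (metis insertE empty_iff length_Cons list.size(3) numeral_3_eq_3)
  then have "xs = [] \<and> ys = [] \<and> zs = [] \<and> ws = []" by simp
  then show "(i, j, k) \<in> {(a, b, c), (b, c, a), (c, a, b)}"
    using mem by (simp add: cyc_triple)
next
  assume "(i, j, k) \<in> {(a, b, c), (b, c, a), (c, a, b)}"
  then have "[] @ [i] @ [] @ [j] @ [] @ [k] @ [] \<in> cyc [a, b, c]"
    by (auto simp: cyc_triple)
  then show "right_turn (cyc [a, b, c]) i j k"
    unfolding right_turn_def by blast
qed

text \<open>A path through \<open>b\<close> has endpoints \<open>a\<close> and \<open>c\<close>,
  since there are no loops or 2-cycles. From \<open>a\<close> to \<open>c\<close> it turns right, so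
  only the opposite direction is an obstruction.\<close>

lemma proper_vertex_middle:
  assumes "is_quiver Q" "verts Q = {a, b, c}" "distinct [a, b, c]"
  shows "proper_vertex (Q, cyc [a, b, c]) b \<longleftrightarrow> \<not> (arrows Q c b > 0 \<and> arrows Q b a > 0)"
proof -
  have path: "i = a \<and> k = c \<or> i = c \<and> k = a" if "arrows Q i b > 0" "arrows Q b k > 0" for i k
  proof -
    have "i \<in> {a, b, c}" "k \<in> {a, b, c}" "i \<noteq> b" "k \<noteq> b" "i \<noteq> k"
      using assms(1,2) that unfolding is_quiver_def by (metis less_irrefl)+
    then show ?thesis by auto
  qed
  have turn: "right_turn (cyc [a, b, c]) i b k \<longleftrightarrow> i = a \<and> k = c" for i k
    using assms(3) by (auto simp: right_turn_triple)
  show ?thesis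
    unfolding proper_vertex_def fst_conv snd_conv turn using path assms(3)
    by (metis distinct_length_2_or_more)
qed

text \<open>Rotation brings each vertex to the middle. The counterclockwise arrows are those from
  \<open>b\<close> to \<open>a\<close>, \<open>a\<close> to \<open>c\<close> and \<open>c\<close> to
  \<open>b\<close>; each condition forbids two of these kinds from occurring together.\<close>

lemma proper_vertex_triple:
  assumes "is_quiver Q" "verts Q = {a, b, c}" "distinct [a, b, c]"
  shows "proper_vertex (Q, cyc [a, b, c]) a \<longleftrightarrow> \<not> (arrows Q b a > 0 \<and> arrows Q a c > 0)"
    and "proper_vertex (Q, cyc [a, b, c]) b \<longleftrightarrow> \<not> (arrows Q c b > 0 \<and> arrows Q b a > 0)"
    and "proper_vertex (Q, cyc [a, b, c]) c \<longleftrightarrow> \<not> (arrows Q a c > 0 \<and> arrows Q c b > 0)"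
proof -
  have "cyc [a, b, c] = cyc [b, c, a]" "cyc [a, b, c] = cyc [c, a, b]"
    by (auto simp: cyc_triple)
  moreover have "verts Q = {b, c, a}" "verts Q = {c, a, b}"
    using assms(2) by auto
  ultimately show "proper_vertex (Q, cyc [a, b, c]) a \<longleftrightarrow> \<not> (arrows Q b a > 0 \<and> arrows Q a c > 0)"
    and "proper_vertex (Q, cyc [a, b, c]) b \<longleftrightarrow> \<not> (arrows Q c b > 0 \<and> arrows Q b a > 0)"
    and "proper_vertex (Q, cyc [a, b, c]) c \<longleftrightarrow> \<not> (arrows Q a c > 0 \<and> arrows Q c b > 0)"
    using proper_vertex_middle[of Q a b c] proper_vertex_middle[of Q b c a]
      proper_vertex_middle[of Q c a b] assms by auto
qed

text \<open>Rotation preserves distinctness and the set of entries, so the choice of representative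
  does not matter.\<close>

lemma cyclic_ordering_cyc:
  "cyclic_ordering V (cyc vs) \<longleftrightarrow> distinct vs \<and> set vs = V"
proof -
  have "distinct vs \<and> set vs = set ws" if "cyc vs = cyc ws" "distinct ws" for ws :: "'a list"
  proof -
    have "vs \<in> cyc ws"
      using mem_cyc[of vs] that(1) by simp
    then obtain n where "vs = rotate n ws"
      by (auto simp: cyc_def)
    then show ?thesis using that(2) by simp
  qed
  then show ?thesis by (auto simp: cyclic_ordering_def)
qed

section \<open>Properness up to wiggles\<close>

lemma is_coq_wiggle: "wiggle C D \<Longrightarrow> is_coq C \<Longrightarrow> is_coq D"
  by (auto simp: is_coq_def cyclic_ordering_cyc elim!: wiggle.cases)

lemma is_coq_proper_mutation: "proper_mutation j C D \<Longrightarrow> is_coq C \<Longrightarrow> is_coq D"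
  by (auto simp: is_coq_def cyclic_ordering_cyc is_quiver_mutate elim!: proper_mutation.cases)

lemma wiggle_sym: "wiggle C D \<Longrightarrow> wiggle D C"
  by (auto simp: adjacent_def elim!: wiggle.cases intro!: wiggle.intros[simplified])

lemma proper_coq_wiggle:
  assumes "wiggle C D" "proper_coq C"
  shows "proper_coq D"
proof -
  have "fst D = fst C" using assms(1) by (auto elim: wiggle.cases)
  moreover have "wiggle_equivalent D C"
    using wiggle_sym[OF assms(1)] unfolding wiggle_equivalent_def by blast
  ultimately show ?thesis
    using assms(2) unfolding proper_coq_def wiggle_equivalent_def
    by (metis equivclp_trans)
qed

text \<open>Holds vacuously: the swapped entries are distinct, hence adjacent. The form
  \<open>D = C\<close> suits induction along a chain of wiggles.\<close>

lemma wiggle_complete: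
  assumes "wiggle C D" "is_coq C"
    and "\<forall>u\<in>verts (fst C). \<forall>v\<in>verts (fst C). u \<noteq> v \<longrightarrow> adjacent (fst C) u v"
  shows "D = C"
  using assms(1)
proof cases
  case (1 Q u v xs ys)
  then have "u \<in> verts Q" "v \<in> verts Q" "u \<noteq> v"
    using assms(2) by (auto simp: is_coq_def cyclic_ordering_cyc)
  then show ?thesis using 1 assms(3) by auto
qed

lemma wiggle_equivalent_complete:
  assumes "wiggle_equivalent C D" "is_coq C"
    and "\<forall>u\<in>verts (fst C). \<forall>v\<in>verts (fst C). u \<noteq> v \<longrightarrow> adjacent (fst C) u v"
  shows "D = C"
  using assms(1) unfolding wiggle_equivalent_def
proof (induction rule: equivclp_induct)
  case (step D E)
  then show ?case using wiggle_complete assms(2,3) wiggle_sym by metis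
qed simp

text \<open>The wiggle class is just \<open>C\<close>, so \<open>C\<close> itself must witness
  properness at every vertex.\<close>

lemma proper_coq_complete:
  assumes "is_coq C"
    and "\<forall>u\<in>verts (fst C). \<forall>v\<in>verts (fst C). u \<noteq> v \<longrightarrow> adjacent (fst C) u v"
  shows "proper_coq C \<longleftrightarrow> (\<forall>j\<in>verts (fst C). proper_vertex C j)"
proof -
  have "wiggle_equivalent C C" by (simp add: wiggle_equivalent_def)
  then show ?thesis
    using wiggle_equivalent_complete[OF _ assms] unfolding proper_coq_def by metis
qed

text \<open>Three points have only two cyclic orderings, and swapping \<open>u\<close> with
  \<open>v\<close> exchanges them.\<close>

lemma is_coq_triple:
  assumes "is_coq C" "card (verts (fst C)) = 3" "u \<in> verts (fst C)" "v \<in> verts (fst C)" "u \<noteq> v"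
  obtains w where "distinct [u, v, w]" "verts (fst C) = {u, v, w}"
    "snd C = cyc [u, v, w] \<or> snd C = cyc [v, u, w]"
proof -
  obtain vs where vs: "distinct vs" "set vs = verts (fst C)" "snd C = cyc vs"
    using assms(1) by (auto simp: is_coq_def cyclic_ordering_def)
  then have "length vs = 3" using assms(2) distinct_card[of vs] by simp
  then obtain a b c where abc: "vs = [a, b, c]"
    by (auto simp: numeral_3_eq_3 length_Suc_conv)
  have uv: "u \<in> {a, b, c}" "v \<in> {a, b, c}"
    using vs(2) abc assms(3,4) by auto
  then obtain w where w: "w \<in> {a, b, c}" "w \<noteq> u" "w \<noteq> v"
    using vs(1) abc by auto
  have "{a, b, c} = {u, v, w}"
    using uv w assms(5) by auto
  moreover have "cyc [a, b, c] = cyc [u, v, w] \<or> cyc [a, b, c] = cyc [v, u, w]"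
    using uv w assms(5) by (auto simp: cyc_triple)
  ultimately show ?thesis
    using that[of w] w(2,3) assms(5) vs(2,3) abc by simp
qed

text \<open>A vertex of a 3-vertex quiver is the middle of at most one path, hence is proper in one of
  the two cyclic orderings; a wiggle at the nonadjacent pair exchanges these orderings.\<close>

lemma proper_coq_nonadjacent:
  assumes "is_coq C" "card (verts (fst C)) = 3"
    and "u \<in> verts (fst C)" "v \<in> verts (fst C)" "u \<noteq> v" "\<not> adjacent (fst C) u v"
  shows "proper_coq C"
proof -
  obtain w where w: "distinct [u, v, w]" "verts (fst C) = {u, v, w}"
    "snd C = cyc [u, v, w] \<or> snd C = cyc [v, u, w]"
    using is_coq_triple assms by metis
  define Q where "Q = fst C"
  have "wiggle (Q, cyc [u, v, w]) (Q, cyc [v, u, w])"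
    using wiggle.intros[of Q u v "[]" "[w]"] assms(6) by (simp add: Q_def)
  then have eq: "wiggle_equivalent C (Q, cyc [u, v, w])" "wiggle_equivalent C (Q, cyc [v, u, w])"
    using w(3) wiggle_sym unfolding wiggle_equivalent_def Q_def
    by (metis equivclp_refl prod.collapse r_into_equivclp)+
  have "is_quiver Q" "verts Q = {u, v, w}" "verts Q = {v, u, w}"
    using assms(1) w(2) by (auto simp: is_coq_def Q_def)
  \<comment> \<open>No path has \<open>u\<close> or \<open>v\<close> in the middle. Failure at
    \<open>w\<close> in both orderings would need arrows both ways between \<open>u\<close> and
    \<open>w\<close>.\<close>
  then have "proper_vertex (Q, cyc [u, v, w]) j \<or> proper_vertex (Q, cyc [v, u, w]) j"
    if "j \<in> verts Q" for j
    using that w(1) assms(6) proper_vertex_triple[of Q u v w] proper_vertex_triple[of Q v u w]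
    unfolding is_quiver_def adjacent_def Q_def[symmetric] by (simp; metis less_irrefl)
  then show ?thesis unfolding proper_coq_def Q_def using eq[unfolded Q_def] by blast
qed

section \<open>Preservation under proper mutation\<close>

lemma proper_coq_proper_mutation:
  assumes mut: "proper_mutation j C D"
    and C: "is_coq C" "card (verts (fst C)) = 3" "proper_coq C"
  shows "proper_coq D"
proof -
  have D: "is_coq D" using is_coq_proper_mutation mut C(1) .
  obtain Q xs ys where CD: "C = (Q, cyc (j # xs @ ys))" "D = (mutate j Q, cyc (xs @ j # ys))"
    and j: "j \<in> verts Q" and pj: "proper_vertex (Q, cyc (j # xs @ ys)) j"
    and out: "Out_nbrs Q j \<subseteq> set xs" and inn: "In_nbrs Q j \<inter> set xs = {}"
    using mut by (auto elim: proper_mutation.cases)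
  have quiver: "is_quiver Q" and dist: "distinct (j # xs @ ys)" "set (j # xs @ ys) = verts Q"
    using C(1) by (auto simp: is_coq_def cyclic_ordering_cyc CD)
  then have "length (xs @ ys) = 2"
    using C(2) distinct_card[OF dist(1)] CD by simp
  then obtain p q where pq: "xs @ ys = [p, q]"
    by (metis (no_types, lifting) length_0_conv length_Suc_conv numeral_2_eq_2)
  have ne: "j \<noteq> p" "j \<noteq> q" "p \<noteq> q" and V: "verts Q = {j, p, q}"
    using dist pq by auto
  show ?thesis
  proof (cases "\<forall>u\<in>verts Q. \<forall>v\<in>verts Q. u \<noteq> v \<longrightarrow> adjacent (mutate j Q) u v")
    case False
    then show ?thesis
      using proper_coq_nonadjacent[OF D] C(2) by (auto simp: CD)
  next
    case True
    define A where "A = arrows Q"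
    define B where "B = arrows (mutate j Q)"
    have B: "B j p = A p j" "B p j = A j p" "B j q = A q j" "B q j = A j q"
      "B p q = (A p q + A p j * A j q) - (A q p + A q j * A j p)"
      "B q p = (A q p + A q j * A j p) - (A p q + A p j * A j q)"
      using ne by (simp_all add: A_def B_def arrows_mutate_at quiver arrows_mutate_away)
    \<comment> \<open>Mutation only reverses arrows at \<open>j\<close>, so \<open>p\<close> and
      \<open>q\<close> are the only pair that can be nonadjacent in \<open>Q\<close>.\<close>
    have adj: "A p j > 0 \<or> A j p > 0" "A q j > 0 \<or> A j q > 0"
      using True V ne B(1-4) unfolding adjacent_def B_def[symmetric] by auto
    have C': "C = (Q, cyc [j, p, q])" using pq CD by simp
    note proper = proper_vertex_triple[OF quiver V, folded A_def C']
    have "\<not> (A p j > 0 \<and> A j q > 0)"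
      using pj proper ne by (simp add: C' pq)
    \<comment> \<open>If \<open>p\<close> and \<open>q\<close> are adjacent, \<open>Q\<close> is
      complete; otherwise the conditions on \<open>A q p\<close> below hold trivially.\<close>
    moreover have "\<forall>v\<in>verts Q. proper_vertex C v" if "A p q > 0 \<or> A q p > 0"
    proof -
      have "\<forall>u\<in>verts Q. \<forall>v\<in>verts Q. u \<noteq> v \<longrightarrow> adjacent Q u v"
        using that adj V unfolding adjacent_def A_def[symmetric] by auto
      then show ?thesis
        using C(3) proper_coq_complete[OF C(1)] by (simp add: CD(1))
    qed
    ultimately have old: "\<not> (A p j > 0 \<and> A j q > 0)" "\<not> (A q p > 0 \<and> A p j > 0)"
      "\<not> (A j q > 0 \<and> A q p > 0)"
      using proper ne V by auto
    note quiver' = is_quiver_mutate[OF quiver j]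
    have V': "verts (mutate j Q) = {j, p, q}" "verts (mutate j Q) = {p, j, q}"
      using V by auto
    consider "xs = []" "ys = [p, q]" | "xs = [p]" "ys = [q]" | "xs = [p, q]" "ys = []"
      using pq by (cases xs; cases "tl xs") (auto simp: append_eq_Cons_conv)
    then have "\<forall>v\<in>verts Q. proper_vertex D v"
    proof cases
      \<comment> \<open>A sink: \<open>old\<close> excludes arrows from \<open>q\<close> to
        \<open>p\<close>, so after mutation only the pair of \<open>j\<close> and \<open>q\<close>
        is counterclockwise.\<close>
      case 1
      then have "A j p = 0" "A j q = 0" using out by (auto simp: Out_nbrs_def A_def)
      moreover have "D = (mutate j Q, cyc [j, p, q])" using 1 CD by simp
      ultimately show ?thesis
        using proper_vertex_triple[OF quiver' V'(1), folded B_def] old adj B V ne by auto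
    next
      \<comment> \<open>The new arrows from \<open>p\<close> to \<open>j\<close> and from
        \<open>j\<close> to \<open>q\<close> are clockwise, leaving only the pair of
        \<open>p\<close> and \<open>q\<close> undetermined.\<close>
      case 2
      then have "A p j = 0" "A j q = 0" using inn out ne by (auto simp: In_nbrs_def Out_nbrs_def A_def)
      moreover have "D = (mutate j Q, cyc [p, j, q])" using 2 CD by simp
      ultimately show ?thesis
        using proper_vertex_triple[OF quiver' V'(2), folded B_def] old adj B V ne by auto
    next
      \<comment> \<open>A source: passing both vertices restores the cyclic ordering, and
        \<open>old\<close> again excludes arrows from \<open>q\<close> to \<open>p\<close>.\<close>
      case 3
      then have "A p j = 0" "A q j = 0" using inn ne by (auto simp: In_nbrs_def A_def)
      moreover have "D = (mutate j Q, cyc [j, p, q])" using 3 CD by (auto simp: cyc_triple)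
      ultimately show ?thesis
        using proper_vertex_triple[OF quiver' V'(1), folded B_def] old adj B V ne by auto
    qed
    then show ?thesis
      using proper_coq_complete[OF D] True by (simp add: CD)
  qed
qed

theorem proposition15p1:
  fixes Q :: "'a quiver" and \<sigma> :: "'a list set"
  assumes "is_coq (Q, \<sigma>)"
    and "card (verts Q) = 3"
    and "proper_coq (Q, \<sigma>)"
  shows "totally_proper (Q, \<sigma>)"
proof -
  \<comment> \<open>Being a COQ on three vertices joins the invariant because preservation of
    properness depends on it.\<close>
  have "is_coq D \<and> card (verts (fst D)) = 3 \<and> proper_coq D"
    if "D \<in> proper_mutation_class (Q, \<sigma>)" for D
    using that
  proof induction
    case base
    then show ?case using assms by simp
  next
    case (wiggle D D')
    then have "fst D' = fst D" by (auto elim: wiggle.cases)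
    then show ?case using wiggle is_coq_wiggle proper_coq_wiggle by metis
  next
    case (mutation D j D')
    then have "verts (fst D') = verts (fst D)" by (auto elim: proper_mutation.cases)
    then show ?case using mutation is_coq_proper_mutation proper_coq_proper_mutation by metis
  qed
  then show ?thesis by (simp add: totally_proper_def)
qed

end
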